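(* Let $\Sigma=(n,Q,\{(A_q,B_q,C_q)\mid q\in Q\})$ be an LSS (in continuous or discrete time) with a controllability grammian $\mathcal{P}>0$ and an observability grammian $\mathcal{R}>0$, let $r<n$, and let $\hat\Sigma$ be the LSS of dimension $r$ returned by the balanced truncation procedure applied to $\Sigma$ with $(\mathcal{P},\mathcal{R})$. Then $\hat\Sigma$ is balanced. In addition, if either $\mathbf{O}(q,\Sigma,\mathcal{R})<0$ for all $q\in Q$, or $\mathbf{C}(q,\Sigma,\mathcal{P})<0$ for all $q\in Q$, then $\hat\Sigma$ is also quadratically stable.
   Context: Let $Q=\{1,\ldots,D\}$, $D\ge1$. A linear switched system (LSS) is a tuple $\Sigma=(n,Q,\{(A_q,B_q,C_q)\mid q\in Q\})$ with $A_q\in\mathbb{R}^{n\times n}$, $B_q\in\mathbb{R}^{n\times m}$, $C_q\in\mathbb{R}^{p\times n}$; it is considered either in continuous time ($\dot x=A_{q(t)}x+B_{q(t)}u$, $y=C_{q(t)}x$) or in discrete time ($x(t+1)=A_{q(t)}x(t)+B_{q(t)}u(t)$, $y(t)=C_{q(t)}x(t)$). Put $\mathbf{O}(q,\Sigma,\mathcal{R})=A_q^T\mathcal{R}+\mathcal{R}A_q+C_q^TC_q$ (continuous time), resp. $A_q^T\mathcal{R}A_q+C_q^TC_q-\mathcal{R}$ (discrete time), and $\mathbf{C}(q,\Sigma,\mathcal{P})=A_q\mathcal{P}+\mathcal{P}A_q^T+B_qB_q^T$ (continuous time), resp. $A_q\mathcal{P}A_q^T+B_qB_q^T-\mathcal{P}$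 (discrete time). An observability grammian of $\Sigma$ is a positive definite $\mathcal{R}$ with $\mathbf{O}(q,\Sigma,\mathcal{R})\le0$ for all $q\in Q$; a controllability grammian is a positive definite $\mathcal{P}$ with $\mathbf{C}(q,\Sigma,\mathcal{P})\le0$ for all $q\in Q$. $\Sigma$ is balanced if some diagonal matrix is simultaneously a controllability and an observability grammian of $\Sigma$; for $\hat\Sigma$ this matrix is $\Lambda_1=\mathrm{diag}(\sigma_1,\ldots,\sigma_r)$ from the procedure below. $\Sigma$ is quadratically stable if there is a positive definite $P$ such that for all $q\in Q$: $A_q^TP+PA_q<0$ (continuous time), resp. $A_q^TPA_q-P<0$ (discrete time). Balanced truncation procedure, applied to $\Sigma$ with $(\mathcal{P},\mathcal{R})$ and $r<n$: find $U$ with $\mathcal{P}=UU^T$ and an orthogonal $K$ with $U^T\mathcal{R}U=K\Lambda^2K^T$, where $\Lambda=\mathrm{diag}(\sigma_1,\ldots,\sigma_n)$, $\sigma_1\ge\cdots\ge\sigma_n>0$. Put $\mathcal{S}=\Lambda^{1/2}K^TU^{-1}$ and $\bar A_q=\mathcal{S}A_q\mathcal{S}^{-1}$, $\bar B_q=\mathcal{S}B_q$, $\bar C_q=C_q\mathcal{S}^{-1}$. Let $\hat A_q$ be the upper left $r\times r$ block of $\bar A_q$, $\hat B_q$ the first $r$ rows of $\bar B_q$, and $\hat C_q$ the first $r$ columns of $\bar C_q$. Return $\hat\Sigma=(r,Q,\{(\hat A_q,\hat B_q,\hat C_q)\mid q\in Q\})$. *)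

theory Defs
  imports Complex_Main "Jordan_Normal_Form.Gauss_Jordan_Elimination"
begin

text \<open>
  A quadratic form can be positive without its matrix being symmetric, so symmetry is
  part of each of the definiteness notions. The equation \<open>transpose_mat M = M\<close> also forces
  \<open>M\<close> to be square.
\<close>

definition pos_def :: "real mat \<Rightarrow> bool" where
  "pos_def M \<longleftrightarrow> transpose_mat M = M \<and>
     (\<forall>x \<in> carrier_vec (dim_row M). x \<noteq> 0\<^sub>v (dim_row M) \<longrightarrow> x \<bullet> (M *\<^sub>v x) > 0)"

definition neg_def :: "real mat \<Rightarrow> bool" where
  "neg_def M \<longleftrightarrow> transpose_mat M = M \<and>
     (\<forall>x \<in> carrier_vec (dim_row M). x \<noteq> 0\<^sub>v (dim_row M) \<longrightarrow> x \<bullet> (M *\<^sub>v x) < 0)"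

definition neg_semidef :: "real mat \<Rightarrow> bool" where
  "neg_semidef M \<longleftrightarrow> transpose_mat M = M \<and>
     (\<forall>x \<in> carrier_vec (dim_row M). x \<bullet> (M *\<^sub>v x) \<le> 0)"

text \<open>
  Orthogonal in the usual sense; \<^const>\<open>orthogonal_mat\<close> only asks for the columns to be
  nonzero and pairwise orthogonal.
\<close>

definition orthonormal_mat :: "nat \<Rightarrow> real mat \<Rightarrow> bool" where
  "orthonormal_mat n K \<longleftrightarrow> K \<in> carrier_mat n n \<and>
     transpose_mat K * K = 1\<^sub>m n \<and> K * transpose_mat K = 1\<^sub>m n"

text \<open>
  The time axis is not a component of the system: the same tuple of matrices is read
  either as \<open>x' = A\<^sub>q x + B\<^sub>q u, y = C\<^sub>q x\<close> or as \<open>x(t+1) = A\<^sub>q x(t) + B\<^sub>q u(t), y = C\<^sub>q x\<close>.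
\<close>

datatype time_axis = Continuous | Discrete

record lss =
  state_dim :: nat
  modes :: "nat set"
  sys_A :: "nat \<Rightarrow> real mat"
  sys_B :: "nat \<Rightarrow> real mat"
  sys_C :: "nat \<Rightarrow> real mat"

text \<open>\<open>m\<close> is the number of inputs and \<open>p\<close> the number of outputs.\<close>

definition is_lss :: "nat \<Rightarrow> nat \<Rightarrow> lss \<Rightarrow> bool" where
  "is_lss m p \<Sigma> \<longleftrightarrow> (\<exists>D\<ge>1. modes \<Sigma> = {1..D}) \<and>
     (\<forall>q \<in> modes \<Sigma>.
        sys_A \<Sigma> q \<in> carrier_mat (state_dim \<Sigma>) (state_dim \<Sigma>) \<and>
        sys_B \<Sigma> q \<in> carrier_mat (state_dim \<Sigma>) m \<and>
        sys_C \<Sigma> q \<in> carrier_mat p (state_dim \<Sigma>))"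

fun obs_op :: "time_axis \<Rightarrow> lss \<Rightarrow> nat \<Rightarrow> real mat \<Rightarrow> real mat" where
  "obs_op Continuous \<Sigma> q R =
     transpose_mat (sys_A \<Sigma> q) * R + R * sys_A \<Sigma> q + transpose_mat (sys_C \<Sigma> q) * sys_C \<Sigma> q"
| "obs_op Discrete \<Sigma> q R =
     transpose_mat (sys_A \<Sigma> q) * R * sys_A \<Sigma> q + transpose_mat (sys_C \<Sigma> q) * sys_C \<Sigma> q - R"

fun ctrb_op :: "time_axis \<Rightarrow> lss \<Rightarrow> nat \<Rightarrow> real mat \<Rightarrow> real mat" where
  "ctrb_op Continuous \<Sigma> q P =
     sys_A \<Sigma> q * P + P * transpose_mat (sys_A \<Sigma> q) + sys_B \<Sigma> q * transpose_mat (sys_B \<Sigma> q)"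
| "ctrb_op Discrete \<Sigma> q P =
     sys_A \<Sigma> q * P * transpose_mat (sys_A \<Sigma> q) + sys_B \<Sigma> q * transpose_mat (sys_B \<Sigma> q) - P"

definition obs_grammian :: "time_axis \<Rightarrow> lss \<Rightarrow> real mat \<Rightarrow> bool" where
  "obs_grammian \<tau> \<Sigma> R \<longleftrightarrow> R \<in> carrier_mat (state_dim \<Sigma>) (state_dim \<Sigma>) \<and> pos_def R \<and>
     (\<forall>q \<in> modes \<Sigma>. neg_semidef (obs_op \<tau> \<Sigma> q R))"

definition ctrb_grammian :: "time_axis \<Rightarrow> lss \<Rightarrow> real mat \<Rightarrow> bool" where
  "ctrb_grammian \<tau> \<Sigma> P \<longleftrightarrow> P \<in> carrier_mat (state_dim \<Sigma>) (state_dim \<Sigma>) \<and> pos_def P \<and>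
     (\<forall>q \<in> modes \<Sigma>. neg_semidef (ctrb_op \<tau> \<Sigma> q P))"

definition balanced_by :: "time_axis \<Rightarrow> lss \<Rightarrow> real mat \<Rightarrow> bool" where
  "balanced_by \<tau> \<Sigma> L \<longleftrightarrow> diagonal_mat L \<and> ctrb_grammian \<tau> \<Sigma> L \<and> obs_grammian \<tau> \<Sigma> L"

definition balanced :: "time_axis \<Rightarrow> lss \<Rightarrow> bool" where
  "balanced \<tau> \<Sigma> \<longleftrightarrow> (\<exists>L. balanced_by \<tau> \<Sigma> L)"

fun lyapunov_op :: "time_axis \<Rightarrow> real mat \<Rightarrow> real mat \<Rightarrow> real mat" where
  "lyapunov_op Continuous A P = transpose_mat A * P + P * A"
| "lyapunov_op Discrete A P = transpose_mat A * P * A - P"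

definition quadratically_stable :: "time_axis \<Rightarrow> lss \<Rightarrow> bool" where
  "quadratically_stable \<tau> \<Sigma> \<longleftrightarrow>
     (\<exists>P \<in> carrier_mat (state_dim \<Sigma>) (state_dim \<Sigma>). pos_def P \<and>
        (\<forall>q \<in> modes \<Sigma>. neg_def (lyapunov_op \<tau> (sys_A \<Sigma> q) P)))"

text \<open>
  The admissible choices in balanced truncation. Indices start at \<open>0\<close>, so
  \<^term>\<open>mat_diag n \<sigma>\<close> is the diagonal matrix with entries \<open>\<sigma> 0, \<dots>, \<sigma> (n - 1)\<close>.
\<close>

definition balancing_factors ::
    "nat \<Rightarrow> real mat \<Rightarrow> real mat \<Rightarrow> real mat \<Rightarrow> real mat \<Rightarrow> (nat \<Rightarrow> real) \<Rightarrow> bool" where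
  "balancing_factors n P R U K \<sigma> \<longleftrightarrow>
     U \<in> carrier_mat n n \<and> P = U * transpose_mat U \<and>
     orthonormal_mat n K \<and>
     transpose_mat U * R * U = K * (mat_diag n \<sigma> * mat_diag n \<sigma>) * transpose_mat K \<and>
     (\<forall>i<n. \<sigma> i > 0) \<and> (\<forall>i j. i \<le> j \<and> j < n \<longrightarrow> \<sigma> j \<le> \<sigma> i)"

text \<open>
  Only used for invertible arguments; \<^const>\<open>mat_inverse\<close> returns \<^const>\<open>None\<close> otherwise.
\<close>

definition minv :: "real mat \<Rightarrow> real mat" where
  "minv M = the (mat_inverse M)"

definition balancing_transform ::
    "nat \<Rightarrow> real mat \<Rightarrow> real mat \<Rightarrow> (nat \<Rightarrow> real) \<Rightarrow> real mat" where
  "balancing_transform n U K \<sigma> = mat_diag n (\<lambda>i. sqrt (\<sigma> i)) * transpose_mat K * minv U"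

definition leading_block :: "nat \<Rightarrow> nat \<Rightarrow> real mat \<Rightarrow> real mat" where
  "leading_block k l M = mat k l (\<lambda>(i, j). M $$ (i, j))"

definition truncate_lss :: "nat \<Rightarrow> real mat \<Rightarrow> lss \<Rightarrow> lss" where
  "truncate_lss r S \<Sigma> =
     \<lparr> state_dim = r, modes = modes \<Sigma>,
       sys_A = (\<lambda>q. leading_block r r (S * sys_A \<Sigma> q * minv S)),
       sys_B = (\<lambda>q. leading_block r (dim_col (sys_B \<Sigma> q)) (S * sys_B \<Sigma> q)),
       sys_C = (\<lambda>q. leading_block (dim_row (sys_C \<Sigma> q)) r (sys_C \<Sigma> q * minv S)) \<rparr>"

text \<open>
  Balanced truncation is not deterministic (neither \<open>U\<close> nor \<open>K\<close> is unique), so it is a relation: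
  \<open>\<Sigma>'\<close> is a possible result, obtained with the diagonal entries \<open>\<sigma>\<close>.
\<close>

definition balanced_truncation ::
    "lss \<Rightarrow> real mat \<Rightarrow> real mat \<Rightarrow> nat \<Rightarrow> (nat \<Rightarrow> real) \<Rightarrow> lss \<Rightarrow> bool" where
  "balanced_truncation \<Sigma> P R r \<sigma> \<Sigma>' \<longleftrightarrow>
     (\<exists>U K. balancing_factors (state_dim \<Sigma>) P R U K \<sigma> \<and>
            \<Sigma>' = truncate_lss r (balancing_transform (state_dim \<Sigma>) U K \<sigma>) \<Sigma>)"

lemma is_lss_balanced_truncation:
  assumes "is_lss m p \<Sigma>" "balanced_truncation \<Sigma> P R r \<sigma> \<Sigma>'"
  shows "is_lss m p \<Sigma>'" "state_dim \<Sigma>' = r" "modes \<Sigma>' = modes \<Sigma>"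
proof -
  have leading: "leading_block k l M \<in> carrier_mat k l" for k l and M :: "real mat"
    by (simp add: leading_block_def)
  have dims: "dim_col (sys_B \<Sigma> q) = m" "dim_row (sys_C \<Sigma> q) = p" if "q \<in> modes \<Sigma>" for q
    using assms(1) that by (auto simp only: is_lss_def carrier_matD)
  show "state_dim \<Sigma>' = r" "modes \<Sigma>' = modes \<Sigma>"
    using assms(2) by (auto simp: balanced_truncation_def truncate_lss_def)
  show "is_lss m p \<Sigma>'"
    using assms leading dims
    by (fastforce simp: is_lss_def balanced_truncation_def truncate_lss_def simp del: One_nat_def)
qed

end

theory Submission
  imports Defs "Jordan_Normal_Form.Determinant"
begin

text \<open>
  The truncated system is a compression of the original one. Let \<open>V\<close> be the first \<open>r\<close> rows of the
  balancing transformation \<open>S\<close>, let \<open>W\<close> be the first \<open>r\<close> columns of \<open>S\<inverse>\<close>, and let \<open>\<Lambda>\<^sub>1\<close> be the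
  diagonal matrix with entries \<open>\<sigma> 0, \<dots>, \<sigma> (r - 1)\<close>. Then the truncated matrices are
  \<open>V A\<^sub>q W\<close>, \<open>V B\<^sub>q\<close> and \<open>C\<^sub>q W\<close>. The inequalities use balancing only through the positivity of
  \<open>\<Lambda>\<^sub>1\<close> and three identities: \<open>V W = 1\<close>, \<open>W\<^sup>T R = \<Lambda>\<^sub>1 V\<close> and \<open>V P = \<Lambda>\<^sub>1 W\<^sup>T\<close>. The last two hold
  because \<open>S\<close> turns both grammians into the same diagonal matrix (\<open>balancing_transform_grammians\<close>),
  and keeping the first rows commutes with multiplication by a diagonal matrix.

  The first two identities say that \<open>W V\<close> is the \<open>R\<close>-orthogonal projection onto the range of \<open>W\<close>
  and that \<open>W\<close> is an isometry from the norm of \<open>\<Lambda>\<^sub>1\<close> to the norm of \<open>R\<close>. Hence the value at \<open>x\<close>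
  of the observability form of the truncated system is at most the value at \<open>W x\<close> of the original
  one: in continuous time the two agree, in discrete time a projection does not increase the norm of
  the next state (\<open>lyapunov_form_compression_le\<close>). As \<open>W\<close> is injective, both the semidefinite
  and the strict inequality pass to the truncated system (\<open>lyapunov_output_compression\<close>).

  Controllability needs no second argument. The controllability operator of \<open>(A, B, C)\<close> is the
  observability operator of the transposed system \<open>(A\<^sup>T, C\<^sup>T, B\<^sup>T)\<close>, and transposition exchanges
  \<open>V\<close> with \<open>W\<^sup>T\<close> and thereby the second identity with the third.

  For stability, a strict observability inequality leaves a strict Lyapunov inequality with matrix
  \<open>\<Lambda>\<^sub>1\<close> once the positive semidefinite term \<open>C\<^sup>T C\<close> is dropped. A strict controllability inequality
  does the same for the transposed matrices, and then \<open>\<Lambda>\<^sub>1\<inverse>\<close> is a common Lyapunov matrix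
  of the truncated system (\<open>lyapunov_duality\<close>).
\<close>

section \<open>Quadratic forms\<close>

lemma mult_vec_scalar_prod:
  fixes M :: "real mat"
  assumes "M \<in> carrier_mat k n" "x \<in> carrier_vec n" "y \<in> carrier_vec k"
  shows "x \<bullet> (transpose_mat M *\<^sub>v y) = (M *\<^sub>v x) \<bullet> y"
  using transpose_vec_mult_scalar[OF assms] assms
  by (simp add: comm_scalar_prod[of _ n] comm_scalar_prod[of _ k])

lemma symmetric_form_commute:
  fixes R :: "real mat"
  assumes "R \<in> carrier_mat n n" "transpose_mat R = R" "x \<in> carrier_vec n" "y \<in> carrier_vec n"
  shows "x \<bullet> (R *\<^sub>v y) = y \<bullet> (R *\<^sub>v x)"
  using mult_vec_scalar_prod[OF assms(1,3,4)] assms by (simp add: comm_scalar_prod[of _ n])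

lemma symmetric_form_diff:
  fixes R :: "real mat"
  assumes R: "R \<in> carrier_mat n n" "transpose_mat R = R"
    and x: "x \<in> carrier_vec n" and y: "y \<in> carrier_vec n"
  shows "(x - y) \<bullet> (R *\<^sub>v (x - y)) = x \<bullet> (R *\<^sub>v x) - 2 * (y \<bullet> (R *\<^sub>v x)) + y \<bullet> (R *\<^sub>v y)"
  using R x y symmetric_form_commute[OF R x y]
  by (simp add: mult_minus_distrib_mat_vec[of _ n n] minus_scalar_prod_distrib[of _ n]
      scalar_prod_minus_distrib[of _ n])

lemma pos_def_form_nonneg:
  assumes "pos_def M" "M \<in> carrier_mat n n" "x \<in> carrier_vec n"
  shows "0 \<le> x \<bullet> (M *\<^sub>v x)"
  using assms by (cases "x = 0\<^sub>v n") (auto simp: pos_def_def less_imp_le)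

lemma mat_diag_cong:
  assumes "\<And>i. i < n \<Longrightarrow> f i = g i"
  shows "mat_diag n f = mat_diag n g"
  using assms by (intro eq_matI) (auto simp: mat_diag_def)

lemma pos_def_mat_diag:
  assumes "\<forall>i<n. f i > (0::real)"
  shows "pos_def (mat_diag n f)"
proof -
  have "0 < x \<bullet> (mat_diag n f *\<^sub>v x)" if x: "x \<in> carrier_vec n" "x \<noteq> 0\<^sub>v n" for x
  proof -
    have entry: "(mat_diag n f *\<^sub>v x) $ i = f i * x $ i" if "i < n" for i
      using x(1) that by (simp add: mat_diag_def scalar_prod_def if_distrib[of "\<lambda>c. c * _"] cong: if_cong)
    have "x \<bullet> (mat_diag n f *\<^sub>v x) = (\<Sum>i = 0..<n. f i * (x $ i)\<^sup>2)"
      using x(1) entry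
      by (simp add: scalar_prod_def mat_diag_def power2_eq_square mult_ac)
    moreover obtain i where "i < n" "x $ i \<noteq> 0"
      using x by (metis carrier_vecD eq_vecI index_zero_vec(1) index_zero_vec(2))
    moreover have "0 \<le> f j * (x $ j)\<^sup>2" if "j < n" for j
      using assms that by (simp add: less_imp_le)
    ultimately show ?thesis
      using assms by (auto intro!: sum_pos2[of _ i])
  qed
  moreover have "transpose_mat (mat_diag n f) = mat_diag n f"
    by (intro eq_matI) (auto simp: mat_diag_def)
  ultimately show ?thesis
    by (auto simp: pos_def_def mat_diag_def)
qed

lemma gram_form:
  fixes C :: "real mat"
  assumes "C \<in> carrier_mat p n" "x \<in> carrier_vec n"
  shows "x \<bullet> ((transpose_mat C * C) *\<^sub>v x) = (C *\<^sub>v x) \<bullet> (C *\<^sub>v x)"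
  using assms mult_vec_scalar_prod[of C p n x "C *\<^sub>v x"]
  by (simp add: assoc_mult_mat_vec[of _ n p _ n])

lemma lyapunov_op_carrier:
  assumes "A \<in> carrier_mat n n" "R \<in> carrier_mat n n"
  shows "lyapunov_op \<tau> A R \<in> carrier_mat n n"
  using assms by (cases \<tau>) auto

lemma lyapunov_op_symmetric:
  assumes "A \<in> carrier_mat n n" "R \<in> carrier_mat n n" "transpose_mat R = R"
  shows "transpose_mat (lyapunov_op \<tau> A R) = lyapunov_op \<tau> A R"
  using assms
  by (cases \<tau>) (auto simp: transpose_add[of _ n n] transpose_minus[of _ n n]
      transpose_mult[of _ n n _ n] assoc_mult_mat[of _ n n _ n _ n]
      intro!: comm_add_mat[of _ n n])

lemma lyapunov_form_continuous:
  assumes A: "A \<in> carrier_mat n n" and R: "R \<in> carrier_mat n n" "transpose_mat R = R"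
    and x: "x \<in> carrier_vec n"
  shows "x \<bullet> (lyapunov_op Continuous A R *\<^sub>v x) = 2 * ((A *\<^sub>v x) \<bullet> (R *\<^sub>v x))"
  using A R x mult_vec_scalar_prod[of A n n x "R *\<^sub>v x"]
    symmetric_form_commute[OF R x, of "A *\<^sub>v x"]
  by (simp add: add_mult_distrib_mat_vec[of _ n n] assoc_mult_mat_vec[of _ n n _ n]
      scalar_prod_add_distrib[of _ n])

lemma lyapunov_form_discrete:
  assumes A: "A \<in> carrier_mat n n" and R: "R \<in> carrier_mat n n"
    and x: "x \<in> carrier_vec n"
  shows "x \<bullet> (lyapunov_op Discrete A R *\<^sub>v x) = (A *\<^sub>v x) \<bullet> (R *\<^sub>v (A *\<^sub>v x)) - x \<bullet> (R *\<^sub>v x)"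
  using A R x mult_vec_scalar_prod[of A n n x "R *\<^sub>v (A *\<^sub>v x)"]
  by (simp add: minus_mult_distrib_mat_vec[of _ n n] assoc_mult_mat_vec[of _ n n _ n]
      assoc_mult_mat[of _ n n _ n _ n] scalar_prod_minus_distrib[of _ n])

lemma lyapunov_output_form:
  assumes "A \<in> carrier_mat n n" "R \<in> carrier_mat n n" "C \<in> carrier_mat p n" "x \<in> carrier_vec n"
  shows "x \<bullet> ((lyapunov_op \<tau> A R + transpose_mat C * C) *\<^sub>v x) =
    x \<bullet> (lyapunov_op \<tau> A R *\<^sub>v x) + (C *\<^sub>v x) \<bullet> (C *\<^sub>v x)"
  using assms lyapunov_op_carrier[OF assms(1,2), of \<tau>] gram_form[OF assms(3,4)]
  by (simp add: add_mult_distrib_mat_vec[of _ n n] scalar_prod_add_distrib[of _ n])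

lemma lyapunov_output_symmetric:
  assumes "A \<in> carrier_mat n n" "R \<in> carrier_mat n n" "transpose_mat R = R" "C \<in> carrier_mat p n"
  shows "transpose_mat (lyapunov_op \<tau> A R + transpose_mat C * C) =
    lyapunov_op \<tau> A R + transpose_mat C * C"
  using assms lyapunov_op_carrier[OF assms(1,2), of \<tau>] lyapunov_op_symmetric[OF assms(1-3), of \<tau>]
  by (simp add: transpose_add[of _ n n] transpose_mult[of _ n p _ n])

text \<open>
  Both operators are a Lyapunov operator plus a Gram matrix. With the pair \<open>(A\<^sup>T, B\<^sup>T)\<close> in
  place of \<open>(A, C)\<close>, every statement about \<open>lyapunov_op \<tau> A R + C\<^sup>T C\<close> becomes one about
  controllability.
\<close>

lemma obs_op_conv_lyapunov_op:
  assumes "sys_A \<Sigma> q \<in> carrier_mat n n" "R \<in> carrier_mat n n" "sys_C \<Sigma> q \<in> carrier_mat p n"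
  shows "obs_op \<tau> \<Sigma> q R =
    lyapunov_op \<tau> (sys_A \<Sigma> q) R + transpose_mat (sys_C \<Sigma> q) * sys_C \<Sigma> q"
  using assms by (cases \<tau>) (auto intro!: eq_matI)

lemma ctrb_op_conv_lyapunov_op:
  assumes "sys_A \<Sigma> q \<in> carrier_mat n n" "P \<in> carrier_mat n n" "sys_B \<Sigma> q \<in> carrier_mat n m"
  shows "ctrb_op \<tau> \<Sigma> q P = lyapunov_op \<tau> (transpose_mat (sys_A \<Sigma> q)) P +
    transpose_mat (transpose_mat (sys_B \<Sigma> q)) * transpose_mat (sys_B \<Sigma> q)"
  using assms by (cases \<tau>) (auto intro!: eq_matI)

lemma neg_def_lyapunov_if_output:
  assumes A: "A \<in> carrier_mat n n" and R: "R \<in> carrier_mat n n" "transpose_mat R = R"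
    and C: "C \<in> carrier_mat p n"
    and neg: "neg_def (lyapunov_op \<tau> A R + transpose_mat C * C)"
  shows "neg_def (lyapunov_op \<tau> A R)"
proof -
  have "x \<bullet> (lyapunov_op \<tau> A R *\<^sub>v x) < 0" if x: "x \<in> carrier_vec n" "x \<noteq> 0\<^sub>v n" for x
  proof -
    have "0 \<le> (C *\<^sub>v x) \<bullet> (C *\<^sub>v x)"
      by (simp add: scalar_prod_def sum_nonneg)
    moreover have "x \<bullet> ((lyapunov_op \<tau> A R + transpose_mat C * C) *\<^sub>v x) < 0"
      using neg x C by (simp add: neg_def_def)
    ultimately show ?thesis
      using lyapunov_output_form[OF A R(1) C x(1)] by simp
  qed
  then show ?thesis
    using lyapunov_op_carrier[OF A R(1), of \<tau>] lyapunov_op_symmetric[OF A R, of \<tau>]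
    by (simp add: neg_def_def)
qed

section \<open>Compression of a Lyapunov inequality\<close>

text \<open>
  Pythagoras: the hypotheses make \<open>z - W V z\<close> orthogonal to the range of \<open>W\<close> with respect to \<open>R\<close>,
  and the \<open>R\<close>-norm of \<open>W V z\<close> is the \<open>L\<close>-norm of \<open>V z\<close>.
\<close>

lemma projected_form_le:
  fixes R L V W :: "real mat"
  assumes R: "R \<in> carrier_mat n n" "pos_def R" and L: "L \<in> carrier_mat r r"
    and V: "V \<in> carrier_mat r n" and W: "W \<in> carrier_mat n r"
    and VW: "V * W = 1\<^sub>m r" and WR: "transpose_mat W * R = L * V"
    and z: "z \<in> carrier_vec n"
  shows "(V *\<^sub>v z) \<bullet> (L *\<^sub>v (V *\<^sub>v z)) \<le> z \<bullet> (R *\<^sub>v z)"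
proof -
  define y where "y = V *\<^sub>v z"
  have y: "y \<in> carrier_vec r" and Wy: "W *\<^sub>v y \<in> carrier_vec n"
    using V W z by (auto simp: y_def)
  have cross: "(W *\<^sub>v y) \<bullet> (R *\<^sub>v u) = y \<bullet> (L *\<^sub>v (V *\<^sub>v u))" if u: "u \<in> carrier_vec n" for u
  proof -
    have "(W *\<^sub>v y) \<bullet> (R *\<^sub>v u) = y \<bullet> (transpose_mat W *\<^sub>v (R *\<^sub>v u))"
      using mult_vec_scalar_prod[OF W y, of "R *\<^sub>v u"] R u by simp
    also have "transpose_mat W *\<^sub>v (R *\<^sub>v u) = (transpose_mat W * R) *\<^sub>v u"
      using W R u by (simp add: assoc_mult_mat_vec[of _ r n _ n])
    also have "\<dots> = L *\<^sub>v (V *\<^sub>v u)"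
      using L V u by (simp add: WR assoc_mult_mat_vec[of _ r r _ n])
    finally show ?thesis .
  qed
  have "V *\<^sub>v (W *\<^sub>v y) = y"
    using assoc_mult_mat_vec[OF V W y] y by (simp add: VW)
  then have "(z - W *\<^sub>v y) \<bullet> (R *\<^sub>v (z - W *\<^sub>v y)) = z \<bullet> (R *\<^sub>v z) - y \<bullet> (L *\<^sub>v y)"
    using symmetric_form_diff[OF R(1) _ z Wy] R(2) cross[OF z] cross[OF Wy]
    by (simp add: pos_def_def y_def)
  moreover have "0 \<le> (z - W *\<^sub>v y) \<bullet> (R *\<^sub>v (z - W *\<^sub>v y))"
    using z Wy by (intro pos_def_form_nonneg[OF R(2,1)]) simp
  ultimately show ?thesis
    by (simp add: y_def)
qed

text \<open>
  The adjoint relation \<open>(V u)\<^sup>T L x = u\<^sup>T R W x\<close> moves the compression from the matrix to the argument.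
  In continuous time it yields equality. In discrete time the form also contains the
  norm of the next state \<open>V A W x\<close>, and this is where a loss occurs.
\<close>

lemma lyapunov_form_compression_le:
  fixes A R L V W :: "real mat"
  assumes A: "A \<in> carrier_mat n n"
    and R: "R \<in> carrier_mat n n" "pos_def R" and L: "L \<in> carrier_mat r r" "transpose_mat L = L"
    and V: "V \<in> carrier_mat r n" and W: "W \<in> carrier_mat n r"
    and VW: "V * W = 1\<^sub>m r" and WR: "transpose_mat W * R = L * V"
    and x: "x \<in> carrier_vec r"
  shows "x \<bullet> (lyapunov_op \<tau> (V * A * W) L *\<^sub>v x) \<le>
    (W *\<^sub>v x) \<bullet> (lyapunov_op \<tau> A R *\<^sub>v (W *\<^sub>v x))"
proof -
  have Wx: "W *\<^sub>v x \<in> carrier_vec n" and AWx: "A *\<^sub>v (W *\<^sub>v x) \<in> carrier_vec n"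
    using A W x by auto
  have VAW: "V * A * W \<in> carrier_mat r r"
    using A V W by auto
  have hat: "(V * A * W) *\<^sub>v x = V *\<^sub>v (A *\<^sub>v (W *\<^sub>v x))"
    using A V W x by (simp add: assoc_mult_mat_vec[of _ r n _ r] assoc_mult_mat_vec[of _ r n _ n]
        assoc_mult_mat_vec[of _ n n _ r] assoc_mult_mat[of _ r n _ n _ r])
  have R_sym: "transpose_mat R = R"
    using R(2) by (simp add: pos_def_def)
  have VWx: "V *\<^sub>v (W *\<^sub>v x) = x"
    using assoc_mult_mat_vec[OF V W x] x by (simp add: VW)
  have cross: "(V *\<^sub>v u) \<bullet> (L *\<^sub>v x) = u \<bullet> (R *\<^sub>v (W *\<^sub>v x))" if u: "u \<in> carrier_vec n" for u
  proof -
    have "(V *\<^sub>v u) \<bullet> (L *\<^sub>v x) = x \<bullet> (L *\<^sub>v (V *\<^sub>v u))"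
      using V u by (intro symmetric_form_commute[OF L _ x]) simp
    also have "L *\<^sub>v (V *\<^sub>v u) = (transpose_mat W * R) *\<^sub>v u"
      using L V u by (simp add: WR assoc_mult_mat_vec[of _ r r _ n])
    also have "\<dots> = transpose_mat W *\<^sub>v (R *\<^sub>v u)"
      using W R u by (simp add: assoc_mult_mat_vec[of _ r n _ n])
    also have "x \<bullet> \<dots> = (W *\<^sub>v x) \<bullet> (R *\<^sub>v u)"
      using mult_vec_scalar_prod[OF W x, of "R *\<^sub>v u"] R u by simp
    also have "\<dots> = u \<bullet> (R *\<^sub>v (W *\<^sub>v x))"
      by (rule symmetric_form_commute[OF R(1) R_sym Wx u])
    finally show ?thesis .
  qed
  show ?thesis
  proof (cases \<tau>)
    case Continuous
    then show ?thesis
      using lyapunov_form_continuous[OF VAW L x] lyapunov_form_continuous[OF A R(1) R_sym Wx]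
        cross[OF AWx] by (simp add: hat)
  next
    case Discrete
    have "x \<bullet> (L *\<^sub>v x) = (W *\<^sub>v x) \<bullet> (R *\<^sub>v (W *\<^sub>v x))"
      using cross[OF Wx] by (simp add: VWx)
    moreover note projected_form_le[OF R L(1) V W VW WR AWx]
    ultimately show ?thesis
      using lyapunov_form_discrete[OF VAW L(1) x] lyapunov_form_discrete[OF A R(1) Wx] Discrete
      by (simp add: hat)
  qed
qed

lemma lyapunov_output_compression:
  fixes A R C L V W :: "real mat" and \<tau> :: time_axis
  assumes A: "A \<in> carrier_mat n n" and C: "C \<in> carrier_mat p n"
    and R: "R \<in> carrier_mat n n" "pos_def R" and L: "L \<in> carrier_mat r r" "transpose_mat L = L"
    and V: "V \<in> carrier_mat r n" and W: "W \<in> carrier_mat n r"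
    and VW: "V * W = 1\<^sub>m r" and WR: "transpose_mat W * R = L * V"
  defines "M \<equiv> lyapunov_op \<tau> A R + transpose_mat C * C"
    and "M' \<equiv> lyapunov_op \<tau> (V * A * W) L + transpose_mat (C * W) * (C * W)"
  shows "neg_semidef M \<Longrightarrow> neg_semidef M'" and "neg_def M \<Longrightarrow> neg_def M'"
proof -
  have VAW: "V * A * W \<in> carrier_mat r r" and CW: "C * W \<in> carrier_mat p r"
    using A C V W by auto
  have dim: "dim_row M = n" "dim_row M' = r"
    using carrier_matD(2)[OF C] carrier_matD(2)[OF CW] by (simp_all add: M_def M'_def)
  have sym: "transpose_mat M' = M'"
    unfolding M'_def by (rule lyapunov_output_symmetric[OF VAW L CW])
  have le: "x \<bullet> (M' *\<^sub>v x) \<le> (W *\<^sub>v x) \<bullet> (M *\<^sub>v (W *\<^sub>v x))" if x: "x \<in> carrier_vec r" for x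
  proof -
    have Wx: "W *\<^sub>v x \<in> carrier_vec n"
      using W x by simp
    show ?thesis
      using lyapunov_form_compression_le[OF A R L V W VW WR x, of \<tau>]
      unfolding M_def M'_def lyapunov_output_form[OF A R(1) C Wx]
        lyapunov_output_form[OF VAW L(1) CW x] assoc_mult_mat_vec[OF C W x] by simp
  qed
  have nonzero: "W *\<^sub>v x \<noteq> 0\<^sub>v n" if "x \<in> carrier_vec r" "x \<noteq> 0\<^sub>v r" for x
  proof
    assume "W *\<^sub>v x = 0\<^sub>v n"
    then have "(V * W) *\<^sub>v x = 0\<^sub>v r"
      using V unfolding assoc_mult_mat_vec[OF V W that(1)]
      by (auto simp: scalar_prod_def)
    then show False
      using that by (simp add: VW)
  qed
  have Wx: "W *\<^sub>v x \<in> carrier_vec n" if "x \<in> carrier_vec r" for x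
    using W that by simp
  show "neg_semidef M'" if "neg_semidef M"
  proof -
    have "x \<bullet> (M' *\<^sub>v x) \<le> 0" if x: "x \<in> carrier_vec r" for x
      using \<open>neg_semidef M\<close> le[OF x] Wx[OF x] unfolding neg_semidef_def dim
      by (meson order_trans)
    then show ?thesis
      using sym by (simp add: neg_semidef_def dim)
  qed
  show "neg_def M'" if "neg_def M"
  proof -
    have "x \<bullet> (M' *\<^sub>v x) < 0" if x: "x \<in> carrier_vec r" "x \<noteq> 0\<^sub>v r" for x
      using \<open>neg_def M\<close> le[OF x(1)] Wx[OF x(1)] nonzero[OF x] unfolding neg_def_def dim
      by (meson le_less_trans)
    then show ?thesis
      using sym by (simp add: neg_def_def dim)
  qed
qed

section \<open>Lyapunov duality\<close>

text \<open>
  The strict inequality for \<open>A\<^sup>T\<close> with matrix \<open>L\<close> is the one for \<open>A\<close> with matrix \<open>L\<inverse>\<close>. In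
  continuous time the two forms are congruent through \<open>x = L y\<close>. In discrete time they express that
  a matrix and its adjoint are both strict contractions, as is also seen from the two Schur complements
  of one block matrix; here the Cauchy-Schwarz step of the contraction argument is done by hand.
\<close>

lemma lyapunov_duality:
  fixes A L N :: "real mat"
  assumes A: "A \<in> carrier_mat n n" and L: "L \<in> carrier_mat n n" "transpose_mat L = L"
    and N: "N \<in> carrier_mat n n" "pos_def N" and inv: "L * N = 1\<^sub>m n"
    and neg: "neg_def (lyapunov_op \<tau> (transpose_mat A) L)"
  shows "neg_def (lyapunov_op \<tau> A N)"
proof -
  have At: "transpose_mat A \<in> carrier_mat n n"
    using A by simp
  have N_sym: "transpose_mat N = N"
    using N(2) by (simp add: pos_def_def)
  have NL: "N * L = 1\<^sub>m n"
    by (rule mat_mult_left_right_inverse[OF L(1) N(1) inv])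
  have LNv: "L *\<^sub>v (N *\<^sub>v v) = v" and NLv: "N *\<^sub>v (L *\<^sub>v v) = v" if "v \<in> carrier_vec n" for v
    using assoc_mult_mat_vec[OF L(1) N(1) that] assoc_mult_mat_vec[OF N(1) L(1) that] that
    by (simp_all add: inv NL)
  have adj: "(transpose_mat A *\<^sub>v u) \<bullet> v = u \<bullet> (A *\<^sub>v v)"
    if "u \<in> carrier_vec n" "v \<in> carrier_vec n" for u v
    by (rule transpose_vec_mult_scalar[OF A that(2,1)])
  have neg': "y \<bullet> (lyapunov_op \<tau> (transpose_mat A) L *\<^sub>v y) < 0"
    if "y \<in> carrier_vec n" "y \<noteq> 0\<^sub>v n" for y
    using neg that lyapunov_op_carrier[OF At L(1), of \<tau>] by (simp add: neg_def_def)
  have "x \<bullet> (lyapunov_op \<tau> A N *\<^sub>v x) < 0" if x: "x \<in> carrier_vec n" "x \<noteq> 0\<^sub>v n" for x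
  proof (cases \<tau>)
    case Continuous
    define y where "y = N *\<^sub>v x"
    have y: "y \<in> carrier_vec n" "L *\<^sub>v y = x"
      using N x LNv by (auto simp: y_def)
    have "y \<noteq> 0\<^sub>v n"
      using y x L by auto
    then have "(transpose_mat A *\<^sub>v y) \<bullet> (L *\<^sub>v y) < 0"
      using neg'[OF y(1)] lyapunov_form_continuous[OF At L y(1)] Continuous by simp
    then have "(A *\<^sub>v x) \<bullet> y < 0"
      using adj[OF y(1) x(1)] y A x by (simp add: comm_scalar_prod[of _ n])
    then show ?thesis
      using lyapunov_form_continuous[OF A N(1) N_sym x(1)] Continuous by (simp add: y_def)
  next
    case Discrete
    \<comment> \<open>With \<open>L\<inverse> = N\<close>, \<open>z\<^sup>T N z = y\<^sup>T A x = w\<^sup>T x \<le> (w\<^sup>T L w + x\<^sup>T N x) / 2\<close>, and the hypothesis at \<open>y\<close>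
      bounds \<open>w\<^sup>T L w\<close> strictly by \<open>y\<^sup>T L y = z\<^sup>T N z\<close>.\<close>
    define z where "z = A *\<^sub>v x"
    define y where "y = N *\<^sub>v z"
    define w where "w = transpose_mat A *\<^sub>v y"
    have car: "z \<in> carrier_vec n" "y \<in> carrier_vec n" "w \<in> carrier_vec n" "L *\<^sub>v w \<in> carrier_vec n"
      using A L N x by (auto simp: z_def y_def w_def)
    have Ly: "L *\<^sub>v y = z"
      using LNv[OF car(1)] by (simp add: y_def)
    have "z \<bullet> (N *\<^sub>v z) < x \<bullet> (N *\<^sub>v x)"
    proof (cases "y = 0\<^sub>v n")
      case True
      then have "z \<bullet> (N *\<^sub>v z) = 0"
        using car(1) by (simp add: y_def)
      then show ?thesis
        using N x by (simp add: pos_def_def)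
    next
      case False
      have "w \<bullet> (L *\<^sub>v w) < y \<bullet> z"
        using neg'[OF car(2) False] lyapunov_form_discrete[OF At L(1) car(2)] Discrete Ly
        by (simp add: w_def)
      moreover have "w \<bullet> x = y \<bullet> z"
        using adj[OF car(2) x(1)] by (simp add: w_def z_def)
      moreover have "0 \<le> x \<bullet> (N *\<^sub>v x) - 2 * (w \<bullet> x) + w \<bullet> (L *\<^sub>v w)"
      proof -
        have "0 \<le> (x - L *\<^sub>v w) \<bullet> (N *\<^sub>v (x - L *\<^sub>v w))"
          using car(4) x(1) by (intro pos_def_form_nonneg[OF N(2,1)]) simp
        moreover have "(L *\<^sub>v w) \<bullet> (N *\<^sub>v x) = w \<bullet> x"
          using symmetric_form_commute[OF N(1) N_sym car(4) x(1)] NLv[OF car(3)] car(3) x(1)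
          by (simp add: comm_scalar_prod[of _ n])
        moreover have "(L *\<^sub>v w) \<bullet> (N *\<^sub>v (L *\<^sub>v w)) = w \<bullet> (L *\<^sub>v w)"
          using NLv[OF car(3)] car(3,4) by (simp add: comm_scalar_prod[of _ n])
        ultimately show ?thesis
          using symmetric_form_diff[OF N(1) N_sym x(1) car(4)] by simp
      qed
      moreover have "z \<bullet> (N *\<^sub>v z) = y \<bullet> z"
        using car by (simp add: y_def comm_scalar_prod[of _ n])
      ultimately show ?thesis
        by linarith
    qed
    then show ?thesis
      using lyapunov_form_discrete[OF A N(1) x(1)] Discrete by (simp add: z_def)
  qed
  then show ?thesis
    using lyapunov_op_carrier[OF A N(1), of \<tau>] lyapunov_op_symmetric[OF A N(1) N_sym, of \<tau>]
    by (simp add: neg_def_def)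
qed

section \<open>The balancing coordinates\<close>

lemma minv_eqI:
  assumes M: "M \<in> carrier_mat n n" and N: "N \<in> carrier_mat n n" and MN: "M * N = 1\<^sub>m n"
  shows "minv M = N"
proof -
  have NM: "N * M = 1\<^sub>m n"
    by (rule mat_mult_left_right_inverse[OF M N MN])
  then have "M \<in> Units (ring_mat TYPE(real) n ())"
    using M N MN by (auto simp: Units_def ring_mat_def)
  then obtain B where B: "mat_inverse M = Some B"
    using mat_inverse(1)[OF M, of "()"] by (cases "mat_inverse M") auto
  then have "M * B = 1\<^sub>m n" "B \<in> carrier_mat n n"
    using mat_inverse(2)[OF M B] by auto
  then have "B = N"
    using assoc_mult_mat[OF N M, of B n] M N NM by simp
  then show ?thesis
    by (simp add: minv_def B)
qed

lemma pos_def_factor_minv: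
  assumes U: "U \<in> carrier_mat n n" and "pos_def (U * transpose_mat U)"
  shows "minv U \<in> carrier_mat n n" "U * minv U = 1\<^sub>m n" "minv U * U = 1\<^sub>m n"
proof -
  have "det (U * transpose_mat U) \<noteq> 0"
    using assms by (subst det_0_iff_vec_prod_zero_field[of _ n]) (auto simp: pos_def_def)
  then have "det U \<noteq> 0"
    using U by (simp add: det_mult[of _ n])
  then obtain B where "B \<in> carrier_mat n n" "U * B = 1\<^sub>m n" "B * U = 1\<^sub>m n"
    using det_non_zero_imp_unit[OF U, of "()"] by (auto simp: Units_def ring_mat_def)
  moreover from this have "minv U = B"
    by (intro minv_eqI[OF U])
  ultimately show "minv U \<in> carrier_mat n n" "U * minv U = 1\<^sub>m n" "minv U * U = 1\<^sub>m n"
    by auto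
qed

text \<open>
  With \<open>T = S\<inverse>\<close> and \<open>\<Lambda>\<close> the diagonal matrix of the \<open>\<sigma>\<^sub>i\<close>, the balancing property is usually
  written \<open>T\<^sup>T R T = \<Lambda> = S P S\<^sup>T\<close>. Cancelling one invertible factor in each gives the last two
  equations, which have the advantage of remaining true when only the first \<open>r\<close> rows are kept.
\<close>

lemma balancing_transform_grammians:
  assumes bf: "balancing_factors n P R U K \<sigma>" and P: "pos_def P"
    and R: "R \<in> carrier_mat n n"
  defines "S \<equiv> balancing_transform n U K \<sigma>"
  shows "S \<in> carrier_mat n n" "minv S \<in> carrier_mat n n" "S * minv S = 1\<^sub>m n"
    "transpose_mat (minv S) * R = mat_diag n \<sigma> * S"
    "S * P = mat_diag n \<sigma> * transpose_mat (minv S)"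
proof -
  note assoc = assoc_mult_mat[of _ n n _ n _ n]
  define D where "D = mat_diag n (\<lambda>i. sqrt (\<sigma> i))"
  define E where "E = mat_diag n (\<lambda>i. 1 / sqrt (\<sigma> i))"
  define G where "G = mat_diag n \<sigma>"
  define Kt where "Kt = transpose_mat K"
  define Ut where "Ut = transpose_mat U"
  define Ui where "Ui = minv U"
  \<comment> \<open>The inverse of \<open>S = D K\<^sup>T U\<inverse>\<close>, with \<open>E = D\<inverse>\<close>.\<close>
  define T where "T = U * K * E"
  have \<sigma>: "sqrt (\<sigma> i) * (1 / sqrt (\<sigma> i)) = 1" "1 / sqrt (\<sigma> i) * (\<sigma> i * \<sigma> i) = \<sigma> i * sqrt (\<sigma> i)"
    "\<sigma> i * (1 / sqrt (\<sigma> i)) = sqrt (\<sigma> i)" if "i < n" for i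
  proof -
    have pos: "\<sigma> i > 0"
      using bf that by (simp add: balancing_factors_def)
    then show "sqrt (\<sigma> i) * (1 / sqrt (\<sigma> i)) = 1"
      by simp
    show 3: "\<sigma> i * (1 / sqrt (\<sigma> i)) = sqrt (\<sigma> i)"
      using pos by (simp add: real_div_sqrt)
    show "1 / sqrt (\<sigma> i) * (\<sigma> i * \<sigma> i) = \<sigma> i * sqrt (\<sigma> i)"
      using arg_cong[OF 3, of "\<lambda>c. \<sigma> i * c"] by (simp only: mult_ac)
  qed
  have U: "U \<in> carrier_mat n n" and K: "K \<in> carrier_mat n n" and KtK: "Kt * K = 1\<^sub>m n"
    and KKt: "K * Kt = 1\<^sub>m n" and P_eq: "P = U * Ut" and Lam: "Ut * R * U = K * (G * G) * Kt"
    using bf by (auto simp: balancing_factors_def orthonormal_mat_def Kt_def Ut_def G_def)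
  have Ui: "Ui \<in> carrier_mat n n" "U * Ui = 1\<^sub>m n" "Ui * U = 1\<^sub>m n"
    using pos_def_factor_minv[OF U] P P_eq by (auto simp: Ui_def Ut_def)
  have car: "D \<in> carrier_mat n n" "E \<in> carrier_mat n n" "G \<in> carrier_mat n n"
    "Kt \<in> carrier_mat n n" "Ut \<in> carrier_mat n n"
    using U K by (auto simp: D_def E_def G_def Kt_def Ut_def)
  have DE: "D * E = 1\<^sub>m n" "E * (G * G) = G * D" "G * E = D"
    unfolding D_def E_def G_def mat_diag_diag mat_diag_one[symmetric]
    by (rule mat_diag_cong; simp only: \<sigma>)+
  have cancel: "M * (N * X) = X"
    if "M * N = 1\<^sub>m n" "M \<in> carrier_mat n n" "N \<in> carrier_mat n n" "X \<in> carrier_mat n n"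
    for M N X :: "real mat"
    using assoc_mult_mat[OF that(2-4)] left_mult_one_mat[OF that(4)] by (simp only: that(1))
  have S_eq: "S = D * Kt * Ui"
    by (simp add: S_def balancing_transform_def D_def Kt_def Ui_def)
  have T: "T \<in> carrier_mat n n"
    using U K car by (auto simp: T_def)
  show S: "S \<in> carrier_mat n n"
    using Ui car by (auto simp: S_eq)
  have "S * T = D * (Kt * (Ui * (U * (K * E))))"
    using U K Ui car by (simp add: S_eq T_def assoc)
  also have "\<dots> = 1\<^sub>m n"
    using U K Ui car by (simp add: cancel[OF Ui(3)] cancel[OF KtK] DE)
  finally have ST: "S * T = 1\<^sub>m n" .
  then have T_eq: "minv S = T"
    by (rule minv_eqI[OF S T])
  show "minv S \<in> carrier_mat n n" "S * minv S = 1\<^sub>m n"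
    by (simp_all add: T_eq T ST)
  have Tt: "transpose_mat T = E * (Kt * Ut)"
  proof -
    have "transpose_mat E = E"
      by (intro eq_matI) (auto simp: E_def mat_diag_def)
    then show ?thesis
      using U K car by (simp add: T_def transpose_mult[of _ n n _ n] Kt_def Ut_def)
  qed
  have UtR: "Ut * R = K * (G * (G * (Kt * Ui)))"
  proof -
    have "Ut * R = Ut * R * U * Ui"
      using U R Ui car by (simp add: assoc)
    also have "\<dots> = K * (G * (G * (Kt * Ui)))"
      using K Ui car by (simp add: Lam assoc)
    finally show ?thesis .
  qed
  have "transpose_mat T * R = E * (Kt * (Ut * R))"
    using R car by (simp add: Tt assoc)
  also have "\<dots> = (E * (G * G)) * (Kt * Ui)"
    using K Ui car by (simp add: UtR cancel[OF KtK] assoc)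
  also have "\<dots> = G * S"
    using Ui car by (simp add: DE S_eq assoc)
  finally show "transpose_mat (minv S) * R = mat_diag n \<sigma> * S"
    by (simp add: T_eq G_def)
  have "S * P = D * (Kt * Ut)"
    using U Ui car by (simp add: S_eq P_eq assoc cancel[OF Ui(3)])
  also have "\<dots> = G * (E * (Kt * Ut))"
    using car by (simp add: DE(3)[symmetric] assoc)
  finally show "S * P = mat_diag n \<sigma> * transpose_mat (minv S)"
    by (simp add: T_eq Tt G_def)
qed

section \<open>Truncation\<close>

lemma leading_block_carrier: "leading_block k l M \<in> carrier_mat k l"
  by (simp add: leading_block_def)

lemma leading_block_self: "M \<in> carrier_mat k l \<Longrightarrow> leading_block k l M = M"
  by (auto simp: leading_block_def)

text \<open>
  The inner index has to run over its full range \<open>b\<close>: truncation is multiplicative only in this sense.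
\<close>

lemma leading_block_mult:
  assumes "X \<in> carrier_mat a b" "Y \<in> carrier_mat b c" "k \<le> a" "l \<le> c"
  shows "leading_block k l (X * Y) = leading_block k b X * leading_block b l Y"
  using assms by (intro eq_matI) (auto simp: leading_block_def scalar_prod_def)

lemma leading_block_transpose:
  assumes "X \<in> carrier_mat a b" "k \<le> a" "l \<le> b"
  shows "leading_block l k (transpose_mat X) = transpose_mat (leading_block k l X)"
  using assms by (intro eq_matI) (auto simp: leading_block_def)

lemma leading_block_mat_diag_mult:
  assumes "X \<in> carrier_mat n c" "k \<le> n" "l \<le> c"
  shows "leading_block k l (mat_diag n f * X) = mat_diag k f * leading_block k l X"
  using assms by (intro eq_matI)
    (auto simp: leading_block_def mat_diag_mult_left[of _ n c] mat_diag_mult_left[of _ k l])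


section \<open>The truncated system\<close>

theorem lemma12:
  fixes \<tau> :: time_axis and \<Sigma> \<Sigma>' :: lss and m p r :: nat
    and P R :: "real mat" and \<sigma> :: "nat \<Rightarrow> real"
  assumes "is_lss m p \<Sigma>"
    and "ctrb_grammian \<tau> \<Sigma> P"
    and "obs_grammian \<tau> \<Sigma> R"
    and "r < state_dim \<Sigma>"
    and "balanced_truncation \<Sigma> P R r \<sigma> \<Sigma>'"
  shows "balanced \<tau> \<Sigma>' \<and> balanced_by \<tau> \<Sigma>' (mat_diag r \<sigma>) \<and>
    ((\<forall>q \<in> modes \<Sigma>. neg_def (obs_op \<tau> \<Sigma> q R)) \<or>
     (\<forall>q \<in> modes \<Sigma>. neg_def (ctrb_op \<tau> \<Sigma> q P)) \<longrightarrow> quadratically_stable \<tau> \<Sigma>')"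
proof -
  define n where "n = state_dim \<Sigma>"
  obtain U K where bf: "balancing_factors n P R U K \<sigma>"
    and \<Sigma>': "\<Sigma>' = truncate_lss r (balancing_transform n U K \<sigma>) \<Sigma>"
    using assms(5) by (auto simp: balanced_truncation_def n_def)
  define S where "S = balancing_transform n U K \<sigma>"
  define T where "T = minv S"
  define L where "L = mat_diag r \<sigma>"
  define V where "V = leading_block r n S"
  define W where "W = leading_block n r T"
  have P: "P \<in> carrier_mat n n" "pos_def P" and R: "R \<in> carrier_mat n n" "pos_def R"
    using assms(2,3) by (auto simp: ctrb_grammian_def obs_grammian_def n_def)
  have rn: "r \<le> n"
    using assms(4) by (simp add: n_def)
  have S: "S \<in> carrier_mat n n" and T: "T \<in> carrier_mat n n" and ST: "S * T = 1\<^sub>m n"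
    and TR: "transpose_mat T * R = mat_diag n \<sigma> * S"
    and SP: "S * P = mat_diag n \<sigma> * transpose_mat T"
    using balancing_transform_grammians[OF bf P(2) R(1)] by (simp_all add: S_def T_def)
  have \<sigma>: "\<forall>i<r. \<sigma> i > 0"
    using bf rn by (simp add: balancing_factors_def)
  have L: "L \<in> carrier_mat r r" "pos_def L"
    using pos_def_mat_diag[OF \<sigma>] by (simp_all add: L_def)
  have L_sym: "transpose_mat L = L"
    using L(2) by (simp add: pos_def_def)
  have V: "V \<in> carrier_mat r n" and W: "W \<in> carrier_mat n r"
    by (simp_all add: V_def W_def leading_block_carrier)
  have VW: "V * W = 1\<^sub>m r"
  proof -
    have "V * W = leading_block r r (1\<^sub>m n)"
      using leading_block_mult[OF S T rn rn] by (simp add: V_def W_def ST)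
    also have "\<dots> = 1\<^sub>m r"
      using rn by (intro eq_matI) (auto simp: leading_block_def)
    finally show ?thesis .
  qed
  have Wt: "transpose_mat W = leading_block r n (transpose_mat T)"
    using leading_block_transpose[OF T order_refl rn] by (simp add: W_def)
  have WR: "transpose_mat W * R = L * V"
  proof -
    have "transpose_mat W * R = leading_block r n (transpose_mat T * R)"
      using leading_block_mult[OF _ R(1) rn order_refl, of "transpose_mat T"] T R(1)
      by (simp add: Wt leading_block_self)
    also have "\<dots> = L * V"
      using leading_block_mat_diag_mult[OF S rn order_refl] by (simp add: TR L_def V_def)
    finally show ?thesis .
  qed
  have VP: "V * P = L * transpose_mat W"
  proof -
    have "V * P = leading_block r n (S * P)"
      using leading_block_mult[OF S P(1) rn order_refl] P(1)
      by (simp add: V_def leading_block_self)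
    also have "\<dots> = L * transpose_mat W"
      using leading_block_mat_diag_mult[OF _ rn order_refl, of "transpose_mat T"] T
      by (simp add: SP L_def Wt)
    finally show ?thesis .
  qed
  have WtVt: "transpose_mat W * transpose_mat V = 1\<^sub>m r"
    using transpose_mult[OF V W] by (simp add: VW)
  have sys: "sys_A \<Sigma> q \<in> carrier_mat n n" "sys_B \<Sigma> q \<in> carrier_mat n m"
    "sys_C \<Sigma> q \<in> carrier_mat p n" if "q \<in> modes \<Sigma>" for q
    using assms(1) that by (auto simp: is_lss_def n_def)
  have dims: "state_dim \<Sigma>' = r" "modes \<Sigma>' = modes \<Sigma>"
    by (simp_all add: \<Sigma>' truncate_lss_def)
  have sys': "sys_A \<Sigma>' q = V * sys_A \<Sigma> q * W" "sys_B \<Sigma>' q = V * sys_B \<Sigma> q"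
    "sys_C \<Sigma>' q = sys_C \<Sigma> q * W" if q: "q \<in> modes \<Sigma>" for q
  proof -
    note A = sys(1)[OF q] and B = sys(2)[OF q] and C = sys(3)[OF q]
    have "leading_block r r (S * sys_A \<Sigma> q * T) = V * sys_A \<Sigma> q * W"
      using leading_block_mult[OF mult_carrier_mat[OF S A] T rn rn]
        leading_block_mult[OF S A rn order_refl] A
      by (simp add: V_def W_def leading_block_self)
    then show "sys_A \<Sigma>' q = V * sys_A \<Sigma> q * W"
      by (simp add: \<Sigma>' truncate_lss_def S_def T_def)
    have "leading_block r m (S * sys_B \<Sigma> q) = V * sys_B \<Sigma> q"
      using leading_block_mult[OF S B rn order_refl] B by (simp add: V_def leading_block_self)
    then show "sys_B \<Sigma>' q = V * sys_B \<Sigma> q"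
      using B by (simp add: \<Sigma>' truncate_lss_def S_def)
    have "leading_block p r (sys_C \<Sigma> q * T) = sys_C \<Sigma> q * W"
      using leading_block_mult[OF C T order_refl rn] C by (simp add: W_def leading_block_self)
    then show "sys_C \<Sigma>' q = sys_C \<Sigma> q * W"
      using C by (simp add: \<Sigma>' truncate_lss_def S_def T_def)
  qed
  have car': "sys_A \<Sigma>' q \<in> carrier_mat r r" "sys_B \<Sigma>' q \<in> carrier_mat r m"
    "sys_C \<Sigma>' q \<in> carrier_mat p r" if "q \<in> modes \<Sigma>" for q
    using sys[OF that] sys'[OF that] V W by simp_all
  have obs: "neg_semidef (obs_op \<tau> \<Sigma> q R) \<Longrightarrow> neg_semidef (obs_op \<tau> \<Sigma>' q L)"
      "neg_def (obs_op \<tau> \<Sigma> q R) \<Longrightarrow> neg_def (obs_op \<tau> \<Sigma>' q L)"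
    if q: "q \<in> modes \<Sigma>" for q
    using lyapunov_output_compression[OF sys(1,3)[OF q] R L(1) L_sym V W VW WR, of \<tau>]
    by (simp_all add: obs_op_conv_lyapunov_op[OF sys(1)[OF q] R(1) sys(3)[OF q]]
        obs_op_conv_lyapunov_op[OF car'(1)[OF q] L(1) car'(3)[OF q]] sys'[OF q])
  have ctrb: "neg_semidef (ctrb_op \<tau> \<Sigma> q P) \<Longrightarrow> neg_semidef (ctrb_op \<tau> \<Sigma>' q L)"
      "neg_def (ctrb_op \<tau> \<Sigma> q P) \<Longrightarrow> neg_def (ctrb_op \<tau> \<Sigma>' q L)"
    if q: "q \<in> modes \<Sigma>" for q
  proof -
    note A = sys(1)[OF q] and B = sys(2)[OF q]
    \<comment> \<open>The compression lemma for the transposed system, with \<open>W\<^sup>T\<close> and \<open>V\<^sup>T\<close> in the roles of \<open>V\<close> and \<open>W\<close>.\<close>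
    have At: "transpose_mat (sys_A \<Sigma> q) \<in> carrier_mat n n"
      and Bt: "transpose_mat (sys_B \<Sigma> q) \<in> carrier_mat m n"
      and Wt_car: "transpose_mat W \<in> carrier_mat r n" and Vt: "transpose_mat V \<in> carrier_mat n r"
      using A B V W by auto
    have VPt: "transpose_mat (transpose_mat V) * P = L * transpose_mat W"
      by (simp add: VP)
    have At': "transpose_mat (sys_A \<Sigma>' q) = transpose_mat W * transpose_mat (sys_A \<Sigma> q) * transpose_mat V"
      unfolding sys'(1)[OF q] transpose_mult[OF mult_carrier_mat[OF V A] W] transpose_mult[OF V A]
      by (rule assoc_mult_mat[OF Wt_car At Vt, symmetric])
    have Bt': "transpose_mat (sys_B \<Sigma>' q) = transpose_mat (sys_B \<Sigma> q) * transpose_mat V"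
      unfolding sys'(2)[OF q] by (rule transpose_mult[OF V B])
    show "neg_semidef (ctrb_op \<tau> \<Sigma> q P) \<Longrightarrow> neg_semidef (ctrb_op \<tau> \<Sigma>' q L)"
      "neg_def (ctrb_op \<tau> \<Sigma> q P) \<Longrightarrow> neg_def (ctrb_op \<tau> \<Sigma>' q L)"
      using lyapunov_output_compression[OF At Bt P L(1) L_sym Wt_car Vt WtVt VPt, of \<tau>]
      unfolding ctrb_op_conv_lyapunov_op[OF A P(1) B]
        ctrb_op_conv_lyapunov_op[OF car'(1)[OF q] L(1) car'(2)[OF q]] At'[symmetric] Bt'[symmetric]
        transpose_transpose by blast+
  qed
  have bal: "balanced_by \<tau> \<Sigma>' L"
    using assms(2,3) L obs(1) ctrb(1)
    by (auto simp: balanced_by_def ctrb_grammian_def obs_grammian_def dims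
        diagonal_mat_def L_def mat_diag_def)
  have stable_obs: "quadratically_stable \<tau> \<Sigma>'" if neg: "\<forall>q \<in> modes \<Sigma>. neg_def (obs_op \<tau> \<Sigma> q R)"
  proof -
    have "neg_def (lyapunov_op \<tau> (sys_A \<Sigma>' q) L)" if q: "q \<in> modes \<Sigma>" for q
      using obs(2)[OF q] neg q
        neg_def_lyapunov_if_output[OF car'(1)[OF q] L(1) L_sym car'(3)[OF q]]
      by (simp add: obs_op_conv_lyapunov_op[OF car'(1)[OF q] L(1) car'(3)[OF q]])
    then show ?thesis
      using L by (auto simp: quadratically_stable_def dims)
  qed
  have stable_ctrb: "quadratically_stable \<tau> \<Sigma>'" if neg: "\<forall>q \<in> modes \<Sigma>. neg_def (ctrb_op \<tau> \<Sigma> q P)"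
  proof -
    define N where "N = mat_diag r (\<lambda>i. 1 / \<sigma> i)"
    have N: "N \<in> carrier_mat r r" "pos_def N"
      using pos_def_mat_diag[of r "\<lambda>i. 1 / \<sigma> i"] \<sigma> by (simp_all add: N_def)
    have LN: "L * N = 1\<^sub>m r"
      unfolding L_def N_def mat_diag_diag using \<sigma>
      by (auto simp flip: mat_diag_one intro!: mat_diag_cong)
    have "neg_def (lyapunov_op \<tau> (sys_A \<Sigma>' q) N)" if q: "q \<in> modes \<Sigma>" for q
    proof -
      have At: "transpose_mat (sys_A \<Sigma>' q) \<in> carrier_mat r r"
        and Bt: "transpose_mat (sys_B \<Sigma>' q) \<in> carrier_mat m r"
        using car'[OF q] by auto
      have "neg_def (lyapunov_op \<tau> (transpose_mat (sys_A \<Sigma>' q)) L)"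
        using ctrb(2)[OF q] neg q neg_def_lyapunov_if_output[OF At L(1) L_sym Bt]
        by (simp add: ctrb_op_conv_lyapunov_op[OF car'(1)[OF q] L(1) car'(2)[OF q]])
      then show ?thesis
        by (rule lyapunov_duality[OF car'(1)[OF q] L(1) L_sym N LN])
    qed
    then show ?thesis
      using N by (auto simp: quadratically_stable_def dims)
  qed
  show ?thesis
    using bal stable_obs stable_ctrb by (auto simp: balanced_def L_def)
qed

end
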